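(* Let $\mathsf{M}$ be a matroid on a finite set $E$ with set of bases $\mathscr{B}$. If $A\subseteq E$ is a stressed subset of $\mathsf{M}$, then $\widetilde{\mathscr{B}}=\mathscr{B}\sqcup \operatorname{cover}(A)$ (a disjoint union) is the set of bases of a matroid $\widetilde{\mathsf{M}}$ on $E$.
   Context: Let $\mathsf{M}$ be a matroid on $E$ of rank $k$ with rank function $\operatorname{rk}$. A subset $A\subseteq E$ is called stressed if both the restriction $\mathsf{M}|_A$ and the contraction $\mathsf{M}/A$ are uniform matroids. The cover of a subset $A\subseteq E$ is $\operatorname{cover}(A)=\{S\subseteq E : |S|=k \text{ and } |S\cap A|\geq \operatorname{rk}(A)+1\}$. *)

theory Defs
  imports Main
begin

text \<open>A matroid is given by its ground set \<open>E\<close> and its set of bases \<open>\<B>\<close>.\<close>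

locale matroid =
  fixes E :: "'a set" and \<B> :: "'a set set"
  assumes finite_ground: "finite E"
    and bases_subset: "B \<in> \<B> \<Longrightarrow> B \<subseteq> E"
    and bases_nonempty: "\<B> \<noteq> {}"
    and basis_exchange:
      "\<lbrakk>B1 \<in> \<B>; B2 \<in> \<B>; x \<in> B1 - B2\<rbrakk> \<Longrightarrow> \<exists>y \<in> B2 - B1. insert y (B1 - {x}) \<in> \<B>"

definition indep :: "'a set set \<Rightarrow> 'a set \<Rightarrow> bool" where
  "indep \<B> I \<longleftrightarrow> (\<exists>B \<in> \<B>. I \<subseteq> B)"

definition rk :: "'a set set \<Rightarrow> 'a set \<Rightarrow> nat" where
  "rk \<B> A = Max (card ` {I. I \<subseteq> A \<and> indep \<B> I})"

text \<open>The bases of the restriction to \<open>A\<close> (ground set \<open>A\<close>) are the maximal independent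
  subsets of \<open>A\<close>.\<close>

definition restriction_bases :: "'a set set \<Rightarrow> 'a set \<Rightarrow> 'a set set" where
  "restriction_bases \<B> A =
    {I. I \<subseteq> A \<and> indep \<B> I \<and> (\<forall>J. J \<subseteq> A \<and> indep \<B> J \<and> I \<subseteq> J \<longrightarrow> J = I)}"

text \<open>The bases of the contraction by \<open>A\<close> (ground set \<open>E - A\<close>) are the sets that a basis \<open>I\<close> of the
  restriction to \<open>A\<close> completes to a basis; in a matroid the choice of \<open>I\<close> does not matter.\<close>

definition contraction_bases :: "'a set \<Rightarrow> 'a set set \<Rightarrow> 'a set \<Rightarrow> 'a set set" where
  "contraction_bases E \<B> A =
    {S. S \<subseteq> E - A \<and> (\<exists>I \<in> restriction_bases \<B> A. S \<union> I \<in> \<B>)}"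

definition uniform_matroid :: "'a set \<Rightarrow> 'a set set \<Rightarrow> bool" where
  "uniform_matroid E \<B> \<longleftrightarrow>
    finite E \<and> (\<exists>r \<le> card E. \<B> = {S. S \<subseteq> E \<and> card S = r})"

definition stressed :: "'a set \<Rightarrow> 'a set set \<Rightarrow> 'a set \<Rightarrow> bool" where
  "stressed E \<B> A \<longleftrightarrow> A \<subseteq> E
    \<and> uniform_matroid A (restriction_bases \<B> A)
    \<and> uniform_matroid (E - A) (contraction_bases E \<B> A)"

definition cover :: "'a set \<Rightarrow> 'a set set \<Rightarrow> 'a set \<Rightarrow> 'a set set" where
  "cover E \<B> A = {S. S \<subseteq> E \<and> card S = rk \<B> E \<and> card (S \<inter> A) \<ge> rk \<B> A + 1}"

end

theory Submission
  imports Defs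
begin

text \<open>Let \<open>r = rk A\<close> and \<open>k = rk E\<close>. Stressedness implies that every \<open>k\<close>-set meeting \<open>A\<close> in
  \<open>r\<close> elements is a basis, so the new family contains every \<open>k\<close>-set meeting \<open>A\<close> in at least \<open>r\<close>
  elements. To remove \<open>x\<close> from \<open>B1\<close> in favour of \<open>B2\<close>: if \<open>B1 - {x}\<close> still has \<open>r\<close> elements in
  \<open>A\<close>, any element of \<open>B2 - B1\<close> will do. Otherwise \<open>B1\<close> is an old basis and \<open>B1 - {x}\<close> has at
  least \<open>k - r\<close> elements outside \<open>A\<close>; if \<open>B2\<close> is in the cover, \<open>k - r\<close> of these together with
  \<open>r\<close> elements of \<open>B2 \<inter> A\<close> form an old basis, and exchanging against that basis can only bring in
  an element of \<open>B2\<close>.\<close>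

section \<open>Basis exchange and extension to a basis\<close>

lemma card_exchange:
  assumes "finite B" "x \<in> B" "y \<notin> B"
  shows "card (insert y (B - {x})) = card B"
  using assms card.remove[OF assms(1,2)] by (simp del: card_Diff_singleton card_Diff_insert)

context matroid
begin

lemma finite_base: "B \<in> \<B> \<Longrightarrow> finite B"
  using bases_subset finite_ground finite_subset by blast

text \<open>Exchanging against \<open>B2\<close> keeps the size of \<open>B1\<close> and shrinks
  \<open>B1 - B2\<close>, so induction reduces to \<open>B1 \<subseteq> B2\<close>.\<close>

lemma card_base_eq:
  assumes "B1 \<in> \<B>" "B2 \<in> \<B>"
  shows "card B1 = card B2"
  using assms(1)
proof (induction "card (B1 - B2)" arbitrary: B1 rule: less_induct)
  case less
  show ?case
  proof (cases "B1 \<subseteq> B2")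
    case True
    \<comment> \<open>Exchange runs the other way: an element of \<open>B2 - B1\<close> would need a
      replacement from the empty set \<open>B1 - B2\<close>.\<close>
    then have "B1 = B2"
      using basis_exchange[OF assms(2) less.prems] by blast
    then show ?thesis by simp
  next
    case False
    then obtain x where x: "x \<in> B1 - B2" by blast
    then obtain y where y: "y \<in> B2 - B1" "insert y (B1 - {x}) \<in> \<B>"
      using basis_exchange[OF less.prems assms(2)] by blast
    have fin: "finite B1" using less.prems by (rule finite_base)
    have "insert y (B1 - {x}) - B2 \<subset> B1 - B2"
      using x y(1) by auto
    then have "card (insert y (B1 - {x}) - B2) < card (B1 - B2)"
      using fin by (intro psubset_card_mono) simp_all
    then have "card (insert y (B1 - {x})) = card B2"
      by (rule less.hyps[OF _ y(2)])
    moreover have "card (insert y (B1 - {x})) = card B1"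
      using fin x y(1) by (intro card_exchange) auto
    ultimately show ?thesis by simp
  qed
qed

text \<open>Start from any basis above \<open>I\<close> and exchange its elements outside
  \<open>I \<union> B0\<close> for elements of \<open>B0\<close> until none is left.\<close>

lemma indep_extend:
  assumes "indep \<B> I" "B0 \<in> \<B>"
  obtains B where "B \<in> \<B>" "I \<subseteq> B" "B \<subseteq> I \<union> B0"
proof -
  obtain C where C: "C \<in> \<B>" "I \<subseteq> C"
    using assms(1) by (auto simp: indep_def)
  then have "\<exists>B \<in> \<B>. I \<subseteq> B \<and> B \<subseteq> I \<union> B0"
  proof (induction "card (C - (I \<union> B0))" arbitrary: C rule: less_induct)
    case less
    show ?case
    proof (cases "C \<subseteq> I \<union> B0")
      case True
      then show ?thesis using less.prems by blast
    next
      case False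
      then obtain x where x: "x \<in> C - B0" "x \<notin> I" by blast
      then obtain y where y: "y \<in> B0 - C" "insert y (C - {x}) \<in> \<B>"
        using basis_exchange[OF less.prems(1) assms(2)] by blast
      have "insert y (C - {x}) - (I \<union> B0) \<subset> C - (I \<union> B0)"
        using x y(1) by auto
      then have "card (insert y (C - {x}) - (I \<union> B0)) < card (C - (I \<union> B0))"
        using finite_base[OF less.prems(1)] by (intro psubset_card_mono) simp_all
      moreover have "I \<subseteq> insert y (C - {x})"
        using less.prems(2) x(2) by blast
      ultimately show ?thesis by (rule less.hyps[OF _ y(2)])
    qed
  qed
  then show thesis using that by blast
qed

section \<open>Independence and rank\<close>

lemma finite_indep: "indep \<B> I \<Longrightarrow> finite I"
  unfolding indep_def using finite_base finite_subset by blast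

lemma finite_indep_cards: "finite (card ` {I. I \<subseteq> X \<and> indep \<B> I})"
proof -
  have "{I. I \<subseteq> X \<and> indep \<B> I} \<subseteq> Pow E"
    using bases_subset by (auto simp: indep_def)
  then show ?thesis
    using finite_ground by (meson finite_Pow_iff finite_imageI finite_subset)
qed

lemma card_indep_le_rk: "I \<subseteq> X \<Longrightarrow> indep \<B> I \<Longrightarrow> card I \<le> rk \<B> X"
  unfolding rk_def using finite_indep_cards by (intro Max_ge) auto

lemma rk_attained:
  obtains I where "I \<subseteq> X" "indep \<B> I" "card I = rk \<B> X"
proof -
  have "{} \<in> {I. I \<subseteq> X \<and> indep \<B> I}"
    using bases_nonempty by (auto simp: indep_def)
  then have "rk \<B> X \<in> card ` {I. I \<subseteq> X \<and> indep \<B> I}"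
    unfolding rk_def using finite_indep_cards by (intro Max_in) auto
  then show thesis using that by auto
qed

lemma card_base:
  assumes "B \<in> \<B>"
  shows "card B = rk \<B> E"
proof (rule antisym)
  show "card B \<le> rk \<B> E"
    using assms bases_subset by (intro card_indep_le_rk) (auto simp: indep_def)
  obtain I where "indep \<B> I" "card I = rk \<B> E"
    using rk_attained by metis
  then obtain C where "C \<in> \<B>" "I \<subseteq> C" "card I = rk \<B> E"
    by (auto simp: indep_def)
  then show "rk \<B> E \<le> card B"
    using card_base_eq[OF assms] card_mono finite_base by metis
qed

lemma card_base_Int_le_rk: "B \<in> \<B> \<Longrightarrow> card (B \<inter> X) \<le> rk \<B> X"
  by (rule card_indep_le_rk) (auto simp: indep_def)

section \<open>Bases of the restriction and the contraction\<close>

lemma restriction_baseI: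
  assumes "I \<subseteq> X" "indep \<B> I" "card I = rk \<B> X"
  shows "I \<in> restriction_bases \<B> X"
proof -
  have "J = I" if "J \<subseteq> X" "indep \<B> J" "I \<subseteq> J" for J
    using card_seteq[OF finite_indep, of J I] card_indep_le_rk[of J X] that assms(3) by simp
  then show ?thesis
    using assms by (auto simp: restriction_bases_def)
qed

text \<open>Extend \<open>I'\<close> to a basis inside \<open>I' \<union> I \<union> S\<close>. As
  \<open>I'\<close> has full rank in \<open>A\<close>, the extension takes nothing more from
  \<open>A\<close>, and counting forces all of \<open>S\<close> into it. This makes the choice of
  \<open>I\<close> in \<open>contraction_bases\<close> immaterial.\<close>

lemma base_replace:
  assumes "I \<subseteq> A" "I' \<subseteq> A" "S \<inter> A = {}" "I \<union> S \<in> \<B>"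
    and I': "indep \<B> I'" "card I' = rk \<B> A" and card: "card I' + card S = rk \<B> E"
  shows "I' \<union> S \<in> \<B>"
proof -
  obtain B where B: "B \<in> \<B>" "I' \<subseteq> B" "B \<subseteq> I' \<union> (I \<union> S)"
    using indep_extend I'(1) assms(4) .
  have "B \<inter> A = I'"
    using card_seteq[of "B \<inter> A" I'] card_base_Int_le_rk[OF B(1)] finite_base[OF B(1)] B(2) assms(2) I'(2)
    by auto
  then have sub: "B \<subseteq> I' \<union> S"
    using B(3) assms(1) by blast
  have "finite S" using finite_base[OF assms(4)] by simp
  moreover have "finite I'" using finite_base[OF B(1)] B(2) finite_subset by blast
  moreover have "I' \<inter> S = {}" using assms(2,3) by blast
  ultimately have "card (I' \<union> S) = card B"
    using card card_base[OF B(1)] by (simp add: card_Un_disjoint)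
  then have "B = I' \<union> S"
    using sub \<open>finite S\<close> \<open>finite I'\<close> by (simp add: card_subset_eq)
  then show ?thesis using B(1) by simp
qed

text \<open>Uniformity leaves the common size open; an independent set attaining the rank pins it
  down.\<close>

lemma stressed_restriction:
  assumes "stressed E \<B> A"
  shows "restriction_bases \<B> A = {I. I \<subseteq> A \<and> card I = rk \<B> A}"
proof -
  obtain q where q: "restriction_bases \<B> A = {I. I \<subseteq> A \<and> card I = q}"
    using assms by (auto simp: stressed_def uniform_matroid_def)
  obtain I where "I \<subseteq> A" "indep \<B> I" "card I = rk \<B> A"
    by (rule rk_attained)
  then have "I \<in> restriction_bases \<B> A" by (rule restriction_baseI)
  then have "q = rk \<B> A" using q \<open>card I = rk \<B> A\<close> by simp
  then show ?thesis using q by simp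
qed

text \<open>Uniformity of the contraction completes \<open>T - A\<close> to a basis by some
  \<open>I \<subseteq> A\<close>; uniformity of the restriction makes \<open>T \<inter> A\<close>
  independent, so it can replace \<open>I\<close>.\<close>

lemma stressed_base:
  assumes st: "stressed E \<B> A"
    and T: "T \<subseteq> E" "card T = rk \<B> E" "card (T \<inter> A) = rk \<B> A"
  shows "T \<in> \<B>"
proof -
  obtain q where q: "q \<le> card (E - A)"
    "contraction_bases E \<B> A = {S. S \<subseteq> E - A \<and> card S = q}"
    using st by (auto simp: stressed_def uniform_matroid_def)
  have contr: "\<exists>I. I \<subseteq> A \<and> card I = rk \<B> A \<and> S \<union> I \<in> \<B>" if "S \<subseteq> E - A" "card S = q" for S
  proof -
    have "S \<in> contraction_bases E \<B> A" using that q(2) by simp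
    then show ?thesis by (auto simp: contraction_bases_def stressed_restriction[OF st])
  qed
  have indep: "indep \<B> (T \<inter> A)"
  proof -
    have "T \<inter> A \<in> restriction_bases \<B> A" using T(3) by (simp add: stressed_restriction[OF st])
    then show ?thesis by (simp add: restriction_bases_def)
  qed
  \<comment> \<open>An arbitrary basis \<open>S0\<close> of the contraction serves to identify
    \<open>q\<close> as \<open>rk \<B> E - rk \<B> A\<close>.\<close>
  obtain S0 where S0: "S0 \<subseteq> E - A" "card S0 = q"
    using q(1) by (rule obtain_subset_with_card_n)
  then obtain I0 where I0: "I0 \<subseteq> A" "card I0 = rk \<B> A" "S0 \<union> I0 \<in> \<B>"
    using contr by blast
  have "card (S0 \<union> I0) = card S0 + card I0"
    using finite_base[OF I0(3)] S0(1) I0(1) by (intro card_Un_disjoint) auto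
  then have k: "rk \<B> E = q + rk \<B> A"
    using card_base[OF I0(3)] S0(2) I0(2) by simp
  have finT: "finite T" using T(1) finite_ground finite_subset by blast
  then have "card (T - A) = q"
    using card_Int_Diff[of T A] T k by simp
  moreover have "T - A \<subseteq> E - A" using T(1) by blast
  ultimately obtain I where I: "I \<subseteq> A" "I \<union> (T - A) \<in> \<B>"
    using contr[of "T - A"] by (auto simp: Un_commute)
  then have "T \<inter> A \<union> (T - A) \<in> \<B>"
    using indep T(3) k \<open>card (T - A) = q\<close>
    by (intro base_replace[OF I(1) _ _ I(2)]) auto
  then show ?thesis by (simp add: Int_Diff_Un)
qed

section \<open>The family enlarged by the cover\<close>

lemma base_disjoint_cover: "\<B> \<inter> cover E \<B> A = {}"
  by (auto simp: cover_def dest: card_base_Int_le_rk[where X = A])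

lemma stressed_relaxation_memI:
  assumes "stressed E \<B> A" "T \<subseteq> E" "card T = rk \<B> E" "rk \<B> A \<le> card (T \<inter> A)"
  shows "T \<in> \<B> \<union> cover E \<B> A"
  using assms stressed_base by (cases "card (T \<inter> A) = rk \<B> A") (auto simp: cover_def)

lemma base_exchange_cover:
  assumes st: "stressed E \<B> A" and B1: "B1 \<in> \<B>" and B2: "B2 \<in> cover E \<B> A"
    and x: "x \<in> B1 - B2" and few: "card ((B1 - {x}) \<inter> A) < rk \<B> A"
  obtains y where "y \<in> B2 - B1" "insert y (B1 - {x}) \<in> \<B>"
proof -
  have fin: "finite B1" using B1 by (rule finite_base)
  have "card (B1 - {x}) = card ((B1 - {x}) \<inter> A) + card (B1 - {x} - A)"
    using fin by (intro card_Int_Diff) simp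
  moreover have "card (B1 - {x}) = rk \<B> E - 1"
    using x fin card_base[OF B1] by simp
  \<comment> \<open>The element lost by removing \<open>x\<close> is offset by the strict inequality
    in \<open>few\<close>.\<close>
  ultimately have "rk \<B> E - rk \<B> A \<le> card (B1 - {x} - A)"
    using few by linarith
  then obtain S where S: "S \<subseteq> B1 - {x} - A" "card S = rk \<B> E - rk \<B> A" "finite S"
    by (rule obtain_subset_with_card_n)
  have "rk \<B> A \<le> card (B2 \<inter> A)"
    using B2 by (simp add: cover_def)
  then obtain I where I: "I \<subseteq> B2 \<inter> A" "card I = rk \<B> A" "finite I"
    by (rule obtain_subset_with_card_n)
  \<comment> \<open>Rules out truncation in \<open>rk \<B> E - rk \<B> A\<close>, so that the sizes
    of \<open>I\<close> and \<open>S\<close> add up.\<close>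
  have "rk \<B> A \<le> rk \<B> E"
  proof -
    have "finite B2"
      using B2 finite_ground finite_subset by (auto simp: cover_def)
    then have "card (B2 \<inter> A) \<le> card B2"
      by (simp add: card_mono)
    then show ?thesis using B2 by (simp add: cover_def)
  qed
  then have card: "card (I \<union> S) = rk \<B> E"
    using S I by (subst card_Un_disjoint) auto
  have "(I \<union> S) \<inter> A = I" using S(1) I(1) by blast
  moreover have "I \<union> S \<subseteq> E"
    using S(1) I(1) B2 bases_subset[OF B1] by (auto simp: cover_def)
  ultimately have "I \<union> S \<in> \<B>"
    using stressed_base[OF st] card I(2) by simp
  moreover have "x \<in> B1 - (I \<union> S)" using x S(1) I(1) by blast
  ultimately obtain y where y: "y \<in> (I \<union> S) - B1" "insert y (B1 - {x}) \<in> \<B>"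
    using basis_exchange[OF B1] by blast
  \<comment> \<open>Since \<open>S \<subseteq> B1\<close>, the new element \<open>y\<close> lies in
    \<open>I\<close>, hence in \<open>B2\<close>.\<close>
  show thesis
    using y S(1) I(1) that by blast
qed

lemma matroid_stressed_relaxation:
  assumes st: "stressed E \<B> A"
  shows "matroid E (\<B> \<union> cover E \<B> A)"
proof
  show "finite E" by (rule finite_ground)
  show sub: "B \<subseteq> E" if "B \<in> \<B> \<union> cover E \<B> A" for B
    using that bases_subset by (auto simp: cover_def)
  show "\<B> \<union> cover E \<B> A \<noteq> {}"
    using bases_nonempty by simp
  fix B1 B2 x
  assume B1: "B1 \<in> \<B> \<union> cover E \<B> A" and B2: "B2 \<in> \<B> \<union> cover E \<B> A" and x: "x \<in> B1 - B2"
  have card: "card B = rk \<B> E" if "B \<in> \<B> \<union> cover E \<B> A" for B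
    using that card_base by (auto simp: cover_def)
  have fin: "finite B1" "finite B2"
    using sub B1 B2 finite_ground finite_subset by metis+
  show "\<exists>y \<in> B2 - B1. insert y (B1 - {x}) \<in> \<B> \<union> cover E \<B> A"
  proof (cases "rk \<B> A \<le> card ((B1 - {x}) \<inter> A)")
    case True
    \<comment> \<open>Both sets have size \<open>rk \<B> E\<close>, so inclusion would mean
      equality, contradicting the choice of \<open>x\<close>.\<close>
    have "\<not> B2 \<subseteq> B1"
      using card_subset_eq[OF fin(1), of B2] card[OF B1] card[OF B2] x by auto
    then obtain y where y: "y \<in> B2 - B1" by blast
    have "card (insert y (B1 - {x})) = rk \<B> E"
      using x y fin(1) card[OF B1] card_exchange[of B1 x y] by simp
    moreover have "insert y (B1 - {x}) \<subseteq> E"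
      using y sub[OF B1] sub[OF B2] by auto
    moreover have "card ((B1 - {x}) \<inter> A) \<le> card (insert y (B1 - {x}) \<inter> A)"
      using fin(1) by (intro card_mono) auto
    ultimately have "insert y (B1 - {x}) \<in> \<B> \<union> cover E \<B> A"
      using True by (intro stressed_relaxation_memI[OF st] order_trans[OF True])
    then show ?thesis using y by blast
  next
    case few: False
    \<comment> \<open>Removing \<open>x\<close> costs at most one element of \<open>A\<close>, so
      \<open>B1\<close> meets \<open>A\<close> in too few elements to lie in the cover.\<close>
    have "card (B1 \<inter> A) - card {x} \<le> card (B1 \<inter> A - {x})"
      by (rule diff_card_le_card_Diff) simp
    moreover have "B1 \<inter> A - {x} = (B1 - {x}) \<inter> A" by blast
    ultimately have "card (B1 \<inter> A) \<le> rk \<B> A"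
      using few by simp
    then have B1': "B1 \<in> \<B>" using B1 by (auto simp: cover_def)
    show ?thesis
    proof (cases "B2 \<in> \<B>")
      case True
      then show ?thesis using basis_exchange[OF B1' _ x] by blast
    next
      case False
      then have "B2 \<in> cover E \<B> A" using B2 by blast
      moreover have "card ((B1 - {x}) \<inter> A) < rk \<B> A" using few by simp
      ultimately obtain y where "y \<in> B2 - B1" "insert y (B1 - {x}) \<in> \<B>"
        using base_exchange_cover[OF st B1' _ x] by blast
      then show ?thesis by blast
    qed
  qed
qed

end

theorem theorem1p1:
  fixes E A :: "'a set" and \<B> :: "'a set set"
  assumes "matroid E \<B>"
    and "stressed E \<B> A"
  shows "\<B> \<inter> cover E \<B> A = {} \<and> matroid E (\<B> \<union> cover E \<B> A)"
  using matroid.base_disjoint_cover[OF assms(1)] matroid.matroid_stressed_relaxation[OF assms]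
  by (rule conjI)

end
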